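(* Assume that $\tilde F\in C^2(\mathbb{R})$ is real-valued. Let $n\in\mathbb{N}$ (with $n\ge1$). For any given $\{(U_k^{(n)},U_k^{(n-1)})\}_{k=-1}^{K+1}$, there exists a constant $R_1=R_1(M_n)>0$ such that for $\Delta t<R_1$ there exists a unique solution $\{U_k^{(n+1)}\}_{k=-1}^{K+1}$, with $\{U_k^{(n+1)}\}_{k=0}^{K}\in X_M$, of the scheme $$\delta_n^{\langle2\rangle}U_k^{(n)}=\delta_k^{\langle2\rangle}\left(\frac{U_k^{(n+1)}+U_k^{(n-1)}}{2}\right)-\frac{d\tilde F}{d(U_k^{(n+1)},U_k^{(n-1)})}\qquad(k=0,\ldots,K),$$ $$\delta_n^{\langle2\rangle}U_0^{(n)}-\delta_k^{\langle1\rangle}\left(\frac{U_0^{(n+1)}+U_0^{(n-1)}}{2}\right)=0,\qquad \delta_n^{\langle2\rangle}U_K^{(n)}+\delta_k^{\langle1\rangle}\left(\frac{U_K^{(n+1)}+U_K^{(n-1)}}{2}\right)=0.$$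
   Context: Let $L,T>0$, let $N,K$ be positive integers, $\Delta t=T/N$, $\Delta x=L/K$. For a family $f_k^{(n)}$ (time index $n$, space index $k$): $\delta_k^+f_k^{(n)}=\frac{f_{k+1}^{(n)}-f_k^{(n)}}{\Delta x}$, $\delta_k^{\langle1\rangle}f_k^{(n)}=\frac{f_{k+1}^{(n)}-f_{k-1}^{(n)}}{2\Delta x}$, $\delta_n^{\langle2\rangle}f_k^{(n)}=\frac{f_k^{(n+1)}-2f_k^{(n)}+f_k^{(n-1)}}{(\Delta t)^2}$, $\delta_k^{\langle2\rangle}f_k^{(n)}=\frac{f_{k+1}^{(n)}-2f_k^{(n)}+f_{k-1}^{(n)}}{(\Delta x)^2}$. Two-point difference quotient: $\frac{d\tilde F}{d(a,b)}=\frac{\tilde F(a)-\tilde F(b)}{a-b}$ if $a\ne b$, and $\tilde F'(a)$ if $a=b$. Trapezoidal sum: $\sum_{k=0}^K{}''f_k\Delta x=\frac12f_0\Delta x+\sum_{k=1}^{K-1}f_k\Delta x+\frac12f_K\Delta x$. For $\boldsymbol U=\{U_k\}_{k=0}^K\in\mathbb{R}^{K+1}$: $\|\boldsymbol U\|_2=\left(\sum_{k=0}^K{}''|U_k|^2\Delta x\right)^{1/2}$ and $\|\boldsymbol U\|_{H^1}=\left(\sum_{k=0}^K{}''|U_k|^2\Delta x+\sum_{k=0}^{K-1}|\delta_k^+U_k|^2\Delta x\right)^{1/2}$. For $\boldsymbol U,\boldsymbol V\in\mathbb{R}^{K+1}$, $$\|(\boldsymbol U,\boldsymbol V)\|_X:=\sqrt{\|\boldsymbol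 U\|_{H^1}^2+\frac1{(\Delta t)^2}\|\boldsymbol V\|_2^2+\frac1{(\Delta t)^2}(|V_0|^2+|V_K|^2)}.$$ Norms of $\boldsymbol U^{(n)},\boldsymbol U^{(n-1)}$ are computed from their components $k=0,\ldots,K$. Set $$M_n:=\|(\boldsymbol U^{(n-1)},\boldsymbol U^{(n)}-\boldsymbol U^{(n-1)})\|_X,\qquad X_M:=\{\boldsymbol U\in\mathbb{R}^{K+1}\mid\|(\boldsymbol U,\boldsymbol U-\boldsymbol U^{(n)})\|_X^2\le3M_n^2\}.$$ The notation $R_1=R_1(M_n)$ means that, for fixed $L$ and $\tilde F$, the constant depends on the given data through $M_n$.
   Formalization: Added hypothesis: if M_n = 0 then F̃'(0) = 0. Without it the claim fails: for F̃(x) = x and zero data, M_n = 0 and X_M = {0}, yet the zero vector does not solve the scheme for any Δt. *)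

theory Defs
  imports "HOL-Analysis.Analysis" "HOL-Library.FuncSet"
begin

text \<open>A spatial grid function is of type \<open>int \<Rightarrow> real\<close>; the ghost indices
  \<open>-1\<close> and \<open>K + 1\<close> are why the index type is \<open>int\<close>. A family
  \<open>U :: nat \<Rightarrow> int \<Rightarrow> real\<close> has the time index first. Finite vectors indexed by
  \<open>{0..K}\<close> or \<open>{-1..K+1}\<close> are extensional functions on these intervals.\<close>

definition diff_plus :: "real \<Rightarrow> (int \<Rightarrow> real) \<Rightarrow> int \<Rightarrow> real" where
  "diff_plus dx f k = (f (k + 1) - f k) / dx"

definition diff_central :: "real \<Rightarrow> (int \<Rightarrow> real) \<Rightarrow> int \<Rightarrow> real" where
  "diff_central dx f k = (f (k + 1) - f (k - 1)) / (2 * dx)"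

definition diff2_space :: "real \<Rightarrow> (int \<Rightarrow> real) \<Rightarrow> int \<Rightarrow> real" where
  "diff2_space dx f k = (f (k + 1) - 2 * f k + f (k - 1)) / dx\<^sup>2"

text \<open>Only meaningful for \<open>n \<ge> 1\<close>, because of the truncated subtraction.\<close>

definition diff2_time :: "real \<Rightarrow> (nat \<Rightarrow> int \<Rightarrow> real) \<Rightarrow> nat \<Rightarrow> int \<Rightarrow> real" where
  "diff2_time dt f n k = (f (n + 1) k - 2 * f n k + f (n - 1) k) / dt\<^sup>2"

definition diff_quot :: "(real \<Rightarrow> real) \<Rightarrow> real \<Rightarrow> real \<Rightarrow> real" where
  "diff_quot F a b = (if a \<noteq> b then (F a - F b) / (a - b) else deriv F a)"

definition C2 :: "(real \<Rightarrow> real) \<Rightarrow> bool" where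
  "C2 F \<longleftrightarrow> F C1_differentiable_on UNIV \<and> deriv F C1_differentiable_on UNIV"

definition trap_sum :: "nat \<Rightarrow> real \<Rightarrow> (int \<Rightarrow> real) \<Rightarrow> real" where
  "trap_sum K dx f =
     1/2 * f 0 * dx + (\<Sum>k = 1..int K - 1. f k * dx) + 1/2 * f (int K) * dx"

definition norm_L2 :: "nat \<Rightarrow> real \<Rightarrow> (int \<Rightarrow> real) \<Rightarrow> real" where
  "norm_L2 K dx U = sqrt (trap_sum K dx (\<lambda>k. \<bar>U k\<bar>\<^sup>2))"

definition norm_H1 :: "nat \<Rightarrow> real \<Rightarrow> (int \<Rightarrow> real) \<Rightarrow> real" where
  "norm_H1 K dx U =
     sqrt (trap_sum K dx (\<lambda>k. \<bar>U k\<bar>\<^sup>2) + (\<Sum>k = 0..int K - 1. \<bar>diff_plus dx U k\<bar>\<^sup>2 * dx))"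

definition norm_X ::
    "nat \<Rightarrow> real \<Rightarrow> real \<Rightarrow> (int \<Rightarrow> real) \<Rightarrow> (int \<Rightarrow> real) \<Rightarrow> real" where
  "norm_X K dx dt U V =
     sqrt ((norm_H1 K dx U)\<^sup>2 + 1 / dt\<^sup>2 * (norm_L2 K dx V)\<^sup>2
           + 1 / dt\<^sup>2 * (\<bar>V 0\<bar>\<^sup>2 + \<bar>V (int K)\<bar>\<^sup>2))"

definition M_data ::
    "nat \<Rightarrow> real \<Rightarrow> real \<Rightarrow> (nat \<Rightarrow> int \<Rightarrow> real) \<Rightarrow> nat \<Rightarrow> real" where
  "M_data K dx dt U n = norm_X K dx dt (U (n - 1)) (\<lambda>k. U n k - U (n - 1) k)"

definition X_M ::
    "nat \<Rightarrow> real \<Rightarrow> real \<Rightarrow> (nat \<Rightarrow> int \<Rightarrow> real) \<Rightarrow> nat \<Rightarrow> (int \<Rightarrow> real) set" where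
  "X_M K dx dt U n =
     {V \<in> {0..int K} \<rightarrow>\<^sub>E UNIV.
        (norm_X K dx dt V (\<lambda>k. V k - U n k))\<^sup>2 \<le> 3 * (M_data K dx dt U n)\<^sup>2}"

text \<open>If \<open>M_data K dx dt U n = 0\<close>, then \<open>U n\<close> and \<open>U (n - 1)\<close> vanish on \<open>{0..K}\<close>
  and \<open>X_M\<close> contains only the zero vector, which solves the scheme below only if
  \<open>deriv F 0 = 0\<close>. Solvability in \<open>X_M\<close> thus has to exclude the case
  \<open>M_data K dx dt U n = 0\<close>, \<open>deriv F 0 \<noteq> 0\<close>.\<close>

definition scheme ::
    "(real \<Rightarrow> real) \<Rightarrow> nat \<Rightarrow> real \<Rightarrow> real \<Rightarrow> (nat \<Rightarrow> int \<Rightarrow> real) \<Rightarrow> nat \<Rightarrow> bool" where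
  "scheme F K dx dt U n \<longleftrightarrow>
     (\<forall>k \<in> {0..int K}.
        diff2_time dt U n k =
          diff2_space dx (\<lambda>j. (U (n + 1) j + U (n - 1) j) / 2) k
          - diff_quot F (U (n + 1) k) (U (n - 1) k)) \<and>
     diff2_time dt U n 0
       - diff_central dx (\<lambda>j. (U (n + 1) j + U (n - 1) j) / 2) 0 = 0 \<and>
     diff2_time dt U n (int K)
       + diff_central dx (\<lambda>j. (U (n + 1) j + U (n - 1) j) / 2) (int K) = 0"

end

theory Submission
  imports Defs
begin

text \<open>Replace the first argument of the difference quotient by its truncation to \<open>[-B, B]\<close>, where
  \<open>B\<close> bounds \<open>X_M\<close> in the supremum norm by a discrete Sobolev inequality. Each equation then
  expresses \<open>V (k + 1)\<close> explicitly through \<open>V k\<close> and \<open>V (k - 1)\<close>; the left boundary condition leaves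
  only \<open>V 0\<close> free, and for small time steps the residual of the right boundary condition is continuous
  and uniformly increasing in \<open>V 0\<close>. So the truncated scheme has exactly one solution. Testing the
  truncated scheme with \<open>V - U (n - 1)\<close> gives an energy estimate that puts its solution into \<open>X_M\<close>,
  where the truncation is inactive; hence the truncated scheme is equivalent to the original one
  within \<open>X_M\<close>.\<close>

section \<open>Shooting method for a three-term boundary value problem\<close>

text \<open>The start value \<open>shoot p q s 1\<close> results from eliminating the ghost value at \<open>-1\<close> between the
  recursion at \<open>0\<close> and the boundary condition \<open>V 1 - V (-1) = q (V 0)\<close>.\<close>

fun shoot :: "(int \<Rightarrow> real \<Rightarrow> real) \<Rightarrow> (real \<Rightarrow> real) \<Rightarrow> real \<Rightarrow> nat \<Rightarrow> real" where
  "shoot p q s 0 = s"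
| "shoot p q s (Suc 0) = s + (p 0 s + q s) / 2"
| "shoot p q s (Suc (Suc k)) =
     2 * shoot p q s (Suc k) - shoot p q s k + p (int (Suc k)) (shoot p q s (Suc k))"

lemma continuous_on_shoot:
  assumes p: "\<And>k. k \<in> {0..int K} \<Longrightarrow> continuous_on UNIV (p k)"
    and q: "continuous_on UNIV q"
    and k: "k \<le> Suc K"
  shows "continuous_on UNIV (\<lambda>s. shoot p q s k)"
  using k
proof (induction k rule: induct_nat_012)
  case 0
  then show ?case by (simp add: continuous_on_id)
next
  case 1
  then show ?case using p[of 0] q by (auto intro!: continuous_intros)
next
  case (ge2 k)
  have "continuous_on UNIV (\<lambda>s. p (int (Suc k)) (shoot p q s (Suc k)))"
    by (rule continuous_on_compose2[OF p ge2.IH(2)]) (use ge2.prems in auto)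
  then show ?case using ge2 by (auto intro!: continuous_intros)
qed

text \<open>The difference of two trajectories has second difference
  \<open>p k (shoot p q t k) - p k (shoot p q s k)\<close>, which is nonnegative as long as the
  trajectories stay ordered, so the difference is discretely convex. Order and growth feed each
  other, hence the joint induction.\<close>

lemma shoot_diff_mono:
  assumes p: "\<And>k. k \<in> {0..int K} \<Longrightarrow> mono (p k)"
    and q: "mono q" and st: "s \<le> t" and k: "k \<le> K"
  shows "t - s \<le> shoot p q t k - shoot p q s k \<and>
    shoot p q t k - shoot p q s k \<le> shoot p q t (Suc k) - shoot p q s (Suc k)"
  using k
proof (induction k)
  case 0
  have "p 0 s \<le> p 0 t" "q s \<le> q t" using p[of 0] q st by (auto dest: monoD)
  then show ?case by (auto simp: field_simps)
next
  case (Suc k)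
  have "shoot p q s (Suc k) \<le> shoot p q t (Suc k)" using Suc st by linarith
  then have "p (int (Suc k)) (shoot p q s (Suc k)) \<le> p (int (Suc k)) (shoot p q t (Suc k))"
    using p[of "int (Suc k)"] Suc.prems by (auto dest: monoD)
  then show ?case using Suc by simp
qed

lemma shoot_unique:
  assumes eq: "\<forall>k\<in>{0..int K}. V (k + 1) - 2 * V k + V (k - 1) = p k (V k)"
    and bc: "V 1 - V (-1) = q (V 0)"
    and k: "k \<le> Suc K"
  shows "V (int k) = shoot p q (V 0) k"
  using k
proof (induction k rule: induct_nat_012)
  case 0
  then show ?case by simp
next
  case 1
  then show ?case using bspec[OF eq, of 0] bc by (simp add: field_simps)
next
  case (ge2 k)
  then show ?case using bspec[OF eq, of "int (Suc k)"] by (simp add: add.commute)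
qed

text \<open>Expansion forces a sign change on the interval of radius
  \<open>\<bar>f 0\<bar> / c\<close>, so the intermediate value theorem applies; it also makes
  \<open>f\<close> strictly increasing.\<close>

lemma ex_zero_of_expanding:
  fixes f :: "real \<Rightarrow> real"
  assumes cont: "continuous_on UNIV f" and c: "c > 0"
    and exp: "\<And>s t. s \<le> t \<Longrightarrow> c * (t - s) \<le> f t - f s"
  shows "\<exists>!s. f s = 0"
proof (rule ex_ex1I)
  let ?r = "\<bar>f 0\<bar> / c"
  have r: "0 \<le> ?r" "c * ?r = \<bar>f 0\<bar>" using c by auto
  have "f (- ?r) \<le> 0" "0 \<le> f ?r"
    using exp[of "- ?r" 0] exp[of 0 ?r] r by auto
  then show "\<exists>s. f s = 0"
    using IVT'[of f "- ?r" 0 ?r] r continuous_on_subset[OF cont] by auto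
next
  fix s t assume "f s = 0" "f t = 0"
  then have "\<not> s < t" "\<not> t < s"
    using exp[of s t] exp[of t s] c by (auto simp: mult_le_0_iff)
  then show "s = t" by auto
qed

text \<open>Solutions correspond to zeros of the right boundary residual as a function of the start
  value. This residual inherits the expansion rate of \<open>r\<close>, since differences of
  trajectories start at \<open>t - s\<close> and never shrink.\<close>

lemma three_term_bvp_ex1:
  fixes p :: "int \<Rightarrow> real \<Rightarrow> real" and q r :: "real \<Rightarrow> real"
  assumes K: "K > 0"
    and p: "\<And>k. k \<in> {0..int K} \<Longrightarrow> continuous_on UNIV (p k)"
           "\<And>k. k \<in> {0..int K} \<Longrightarrow> mono (p k)"
    and q: "continuous_on UNIV q" "mono q"
    and r: "continuous_on UNIV r" "c > 0" "\<And>s t. s \<le> t \<Longrightarrow> c * (t - s) \<le> r t - r s"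
  shows "\<exists>!V. V \<in> {-1..int K + 1} \<rightarrow>\<^sub>E UNIV \<and>
    (\<forall>k\<in>{0..int K}. V (k + 1) - 2 * V k + V (k - 1) = p k (V k)) \<and>
    V 1 - V (-1) = q (V 0) \<and>
    r (V (int K)) + V (int K + 1) - V (int K - 1) = 0"
    (is "\<exists>!V. ?P V")
proof -
  define res where
    "res s = r (shoot p q s K) + shoot p q s (Suc K) - shoot p q s (K - 1)" for s
  have "continuous_on UNIV (\<lambda>s. r (shoot p q s K))"
    by (rule continuous_on_compose2[OF r(1) continuous_on_shoot[OF p(1) q(1)]]) auto
  then have cont: "continuous_on UNIV res"
    unfolding res_def
    by (intro continuous_intros continuous_on_shoot[OF p(1) q(1)]) auto
  have exp: "c * (t - s) \<le> res t - res s" if st: "s \<le> t" for s t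
  proof -
    note d = shoot_diff_mono[where p = p and q = q and K = K, OF p(2) q(2) st]
    \<comment> \<open>Together with the second part of \<open>2\<close>, this makes the contribution
      of \<open>V (K + 1) - V (K - 1)\<close> to the residual nondecreasing; strict growth comes
      from \<open>r\<close> alone.\<close>
    have 1: "shoot p q t (K - 1) - shoot p q s (K - 1) \<le> shoot p q t K - shoot p q s K"
      using d[of "K - 1"] K by simp
    have 2: "t - s \<le> shoot p q t K - shoot p q s K"
      "shoot p q t K - shoot p q s K \<le> shoot p q t (Suc K) - shoot p q s (Suc K)"
      using d[of K] by auto
    have "c * (t - s) \<le> c * (shoot p q t K - shoot p q s K)"
      using 2 r(2) by (intro mult_left_mono) auto
    also have "\<dots> \<le> r (shoot p q t K) - r (shoot p q s K)"
      using 2 st by (intro r(3)) auto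
    finally show ?thesis using 1 2 by (simp add: res_def)
  qed
  have ex1: "\<exists>!s. res s = 0" by (rule ex_zero_of_expanding[OF cont r(2) exp])
  have sol: "V (int k) = shoot p q (V 0) k" if "?P V" "k \<le> Suc K" for V k
    using shoot_unique[of K V p q k] that by blast
  have zero: "res (V 0) = 0" if "?P V" for V
  proof -
    have "V (int K) = shoot p q (V 0) K" "V (int K + 1) = shoot p q (V 0) (Suc K)"
      "V (int K - 1) = shoot p q (V 0) (K - 1)"
      using sol[OF that, of K] sol[OF that, of "Suc K"] sol[OF that, of "K - 1"] K
      by (auto simp: add.commute of_nat_diff)
    then show ?thesis using that unfolding res_def by simp
  qed
  obtain s where s: "res s = 0" using ex1 by blast
  \<comment> \<open>The ghost value at \<open>-1\<close> is read off the left boundary condition,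
    and \<open>undefined\<close> outside the grid makes \<open>V\<close> extensional.\<close>
  define V where "V k = (if k \<in> {-1..int K + 1} then
      if k = -1 then shoot p q s 1 - q s else shoot p q s (nat k) else undefined)" for k
  show ?thesis
  proof (rule ex1I)
    have Vn: "V (int k) = shoot p q s k" if "k \<le> Suc K" for k using that by (simp add: V_def)
    have V0: "V 0 = s" and V1: "V 1 = s + (p 0 s + q s) / 2" and Vm: "V (-1) = V 1 - q s"
      using Vn[of 0] Vn[of 1] by (auto simp: V_def)
    have "V (k + 1) - 2 * V k + V (k - 1) = p k (V k)" if k: "k \<in> {0..int K}" for k
    proof (cases "k = 0")
      case True
      then show ?thesis using V0 V1 Vm by (simp add: field_simps)
    next
      case False
      then obtain j where j: "k = int (Suc j)" using k by (metis atLeastAtMost_iff nonneg_int_cases not0_implies_Suc of_nat_0)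
      have "V (k + 1) = shoot p q s (Suc (Suc j))" "V k = shoot p q s (Suc j)" "V (k - 1) = shoot p q s j"
        using Vn[of "Suc (Suc j)"] Vn[of "Suc j"] Vn[of j] j k by (auto simp: add.commute)
      then show ?thesis using j by simp
    qed
    moreover have "r (V (int K)) + V (int K + 1) - V (int K - 1) = 0"
      using Vn[of K] Vn[of "Suc K"] Vn[of "K - 1"] K s
      by (simp add: res_def add.commute of_nat_diff)
    moreover have "V \<in> {-1..int K + 1} \<rightarrow>\<^sub>E UNIV" by (auto simp: V_def)
    ultimately show "?P V" using V0 Vm by auto
    fix W assume W: "?P W"
    have W0: "W 0 = s" using zero[OF W] s ex1 by blast
    show "W = V"
    proof
      fix k
      consider "k = -1" | "k \<notin> {-1..int K + 1}" | j where "k = int j" "j \<le> Suc K"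
        using nonneg_int_cases[of k] by fastforce
      then show "W k = V k"
      proof cases
        case 1
        have "W (-1) = W 1 - q s" using W W0 by (auto simp: algebra_simps)
        moreover have "W 1 = V 1" using sol[OF W, of 1] Vn[of 1] W0 by simp
        ultimately show ?thesis using 1 Vm by simp
      next
        case 2
        then show ?thesis using W by (auto simp: V_def PiE_def extensional_def)
      next
        case 3
        then show ?thesis using sol[OF W, of j] Vn[of j] W0 by simp
      qed
    qed
  qed
qed

section \<open>Trapezoidal sums and discrete norms\<close>

text \<open>One more cell adds one trapezoid. This fails for \<open>K = 0\<close>, because
  \<open>trap_sum 0 dx f\<close> is \<open>f 0 * dx\<close> and not zero, so inductions start at
  one.\<close>

lemma trap_sum_Suc:
  assumes "K > 0"
  shows "trap_sum (Suc K) dx f = trap_sum K dx f + (f (int K) + f (int K + 1)) / 2 * dx"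
proof -
  have "{1..int (Suc K) - 1} = insert (int K) {1..int K - 1}" using assms by auto
  then show ?thesis by (simp add: trap_sum_def field_simps)
qed

lemma sum_int_Suc: "(\<Sum>k = 0..int (Suc K) - 1. f k) = (\<Sum>k = 0..int K - 1. f k) + f (int K)"
proof -
  have "{0..int (Suc K) - 1} = insert (int K) {0..int K - 1}" by auto
  then show ?thesis by (simp add: add.commute)
qed

lemma trap_sum_add: "trap_sum K dx (\<lambda>k. f k + g k) = trap_sum K dx f + trap_sum K dx g"
  by (simp add: trap_sum_def sum.distrib algebra_simps)

lemma trap_sum_cmult: "trap_sum K dx (\<lambda>k. c * f k) = c * trap_sum K dx f"
  by (simp add: trap_sum_def sum_distrib_left algebra_simps)

lemma trap_sum_const: "K > 0 \<Longrightarrow> trap_sum K dx (\<lambda>k. c) = c * (real K * dx)"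
  by (simp add: trap_sum_def algebra_simps of_nat_diff)

lemma trap_sum_mono:
  assumes "dx \<ge> 0" "\<And>k. k \<in> {0..int K} \<Longrightarrow> f k \<le> g k"
  shows "trap_sum K dx f \<le> trap_sum K dx g"
  unfolding trap_sum_def
  by (intro add_mono sum_mono mult_right_mono mult_left_mono assms) auto

lemma trap_sum_cong:
  assumes "\<And>k. k \<in> {0..int K} \<Longrightarrow> f k = g k"
  shows "trap_sum K dx f = trap_sum K dx g"
  unfolding trap_sum_def using assms by (auto intro!: sum.cong arg_cong2[where f = "(+)"])

lemma trap_sum_nonneg: "dx \<ge> 0 \<Longrightarrow> (\<And>k. f k \<ge> 0) \<Longrightarrow> trap_sum K dx f \<ge> 0"
  unfolding trap_sum_def by (intro add_nonneg_nonneg sum_nonneg mult_nonneg_nonneg) auto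

abbreviation grad_sq :: "nat \<Rightarrow> real \<Rightarrow> (int \<Rightarrow> real) \<Rightarrow> real" where
  "grad_sq K dx f \<equiv> \<Sum>k = 0..int K - 1. (diff_plus dx f k)\<^sup>2 * dx"

lemma grad_sq_nonneg: "dx \<ge> 0 \<Longrightarrow> grad_sq K dx f \<ge> 0"
  by (intro sum_nonneg mult_nonneg_nonneg) auto

lemma norm_X_sq:
  assumes "dx \<ge> 0"
  shows "(norm_X K dx dt f g)\<^sup>2 = trap_sum K dx (\<lambda>k. (f k)\<^sup>2) + grad_sq K dx f +
    (trap_sum K dx (\<lambda>k. (g k)\<^sup>2) + (g 0)\<^sup>2 + (g (int K))\<^sup>2) / dt\<^sup>2"
proof -
  have "trap_sum K dx (\<lambda>k. (h k)\<^sup>2) \<ge> 0" "grad_sq K dx h \<ge> 0" for h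
    using assms by (auto intro!: trap_sum_nonneg grad_sq_nonneg)
  then show ?thesis
    unfolding norm_X_def norm_H1_def norm_L2_def
    by (simp add: add_divide_distrib)
qed

text \<open>Lets the norm in \<open>X_M\<close> be computed from a grid function with ghost values
  instead of its restriction.\<close>

lemma norm_X_cong:
  assumes "\<And>k. k \<in> {0..int K} \<Longrightarrow> f k = f' k" "\<And>k. k \<in> {0..int K} \<Longrightarrow> g k = g' k"
  shows "norm_X K dx dt f g = norm_X K dx dt f' g'"
proof -
  have "trap_sum K dx (\<lambda>k. \<bar>f k\<bar>\<^sup>2) = trap_sum K dx (\<lambda>k. \<bar>f' k\<bar>\<^sup>2)"
    "trap_sum K dx (\<lambda>k. \<bar>g k\<bar>\<^sup>2) = trap_sum K dx (\<lambda>k. \<bar>g' k\<bar>\<^sup>2)"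
    by (rule trap_sum_cong; simp add: assms)+
  moreover have "(\<Sum>k = 0..int K - 1. \<bar>diff_plus dx f k\<bar>\<^sup>2 * dx) =
      (\<Sum>k = 0..int K - 1. \<bar>diff_plus dx f' k\<bar>\<^sup>2 * dx)"
    by (rule sum.cong) (auto simp: diff_plus_def assms)
  ultimately show ?thesis by (simp add: norm_X_def norm_H1_def norm_L2_def assms)
qed

section \<open>Summation by parts and a discrete Sobolev inequality\<close>

text \<open>The identity holds cell by cell: the trapezoid of the left side equals the increment of
  \<open>diff_central dx Z k * y k\<close> minus the product of the forward differences. The
  interior central differences telescope; those at the ends involve the ghost values.\<close>

lemma summation_by_parts:
  assumes "K > 0" "dx \<noteq> 0"
  shows "trap_sum K dx (\<lambda>k. diff2_space dx Z k * y k) =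
    diff_central dx Z (int K) * y (int K) - diff_central dx Z 0 * y 0
    - (\<Sum>k = 0..int K - 1. diff_plus dx Z k * diff_plus dx y k * dx)"
  using assms(1)
proof (induction K rule: nat_induct_non_zero)
  case 1
  show ?case using assms(2)
    by (simp add: trap_sum_def diff2_space_def diff_central_def diff_plus_def
        field_simps power2_eq_square)
next
  case (Suc K)
  have "(diff2_space dx Z (int K) * y (int K) + diff2_space dx Z (int K + 1) * y (int K + 1)) / 2 * dx
      = diff_central dx Z (int K + 1) * y (int K + 1) - diff_central dx Z (int K) * y (int K)
        - diff_plus dx Z (int K) * diff_plus dx y (int K) * dx"
    using assms(2)
    by (simp add: diff2_space_def diff_central_def diff_plus_def field_simps power2_eq_square)
  then show ?case
    unfolding trap_sum_Suc[OF Suc.hyps] sum_int_Suc Suc.IH by (simp add: add.commute field_simps)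
qed

text \<open>Telescoping and Cauchy-Schwarz bound \<open>f k - f j\<close> by the gradient sum.
  Averaging over \<open>j\<close> with the trapezoidal weights, of total mass \<open>L\<close>, then
  replaces the value at \<open>j\<close> by the trapezoidal sum. The constant depends on
  \<open>L\<close> only, not on the grid.\<close>

lemma discrete_sobolev:
  assumes K: "K > 0" and dx: "dx > 0" and k: "k \<in> {0..int K}"
  defines "L \<equiv> real K * dx"
  shows "(f k)\<^sup>2 \<le> (2 / L + 2 * L) * (trap_sum K dx (\<lambda>k. (f k)\<^sup>2) + grad_sq K dx f)"
proof -
  have L: "L > 0" using K dx by (simp add: L_def)
  define P where "P = trap_sum K dx (\<lambda>k. (f k)\<^sup>2)"
  define D where "D = grad_sq K dx f"
  have PD: "P \<ge> 0" "D \<ge> 0" using dx unfolding P_def D_def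
    by (auto intro!: trap_sum_nonneg grad_sq_nonneg)
  have tele: "f (i + int m) - f i = (\<Sum>l = i..i + int m - 1. f (l + 1) - f l)" for i m
  proof (induction m)
    case (Suc m)
    have "{i..i + int (Suc m) - 1} = insert (i + int m) {i..i + int m - 1}" by auto
    then show ?case using Suc by (simp add: algebra_simps)
  qed simp
  have osc_le: "(f j - f i)\<^sup>2 \<le> L * D" if ij: "0 \<le> i" "i \<le> j" "j \<le> int K" for i j
  proof -
    have "(f j - f i)\<^sup>2 = (\<Sum>l = i..j - 1. f (l + 1) - f l)\<^sup>2"
      using tele[of i "nat (j - i)"] ij by simp
    also have "\<dots> \<le> (\<Sum>l = i..j - 1. (f (l + 1) - f l)\<^sup>2) * card {i..j - 1}"
      by (rule sum_squared_le_sum_of_squares)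
    also have "\<dots> \<le> (\<Sum>l = 0..int K - 1. (f (l + 1) - f l)\<^sup>2) * real K"
      using ij by (intro mult_mono sum_mono2 sum_nonneg) auto
    also have "(\<Sum>l = 0..int K - 1. (f (l + 1) - f l)\<^sup>2) = D * dx"
      unfolding D_def sum_distrib_right
      using dx by (intro sum.cong) (simp_all add: diff_plus_def power_divide power2_eq_square)
    finally show ?thesis by (simp add: L_def mult_ac)
  qed
  have "(f k)\<^sup>2 \<le> 2 * (f j)\<^sup>2 + 2 * (L * D)" if j: "j \<in> {0..int K}" for j
  proof -
    have "(f k - f j)\<^sup>2 \<le> L * D"
      using osc_le[of j k] osc_le[of k j] j k by (cases "j \<le> k") (auto simp: power2_commute)
    moreover have "(f k)\<^sup>2 \<le> 2 * (f j)\<^sup>2 + 2 * (f k - f j)\<^sup>2"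
      \<comment> \<open>The gap between the two sides is exactly this square.\<close>
      using zero_le_power2[of "f k - 2 * f j"] by (simp add: power2_eq_square algebra_simps)
    ultimately show ?thesis by linarith
  qed
  then have "trap_sum K dx (\<lambda>j. (f k)\<^sup>2) \<le> trap_sum K dx (\<lambda>j. 2 * (f j)\<^sup>2 + 2 * (L * D))"
    using dx by (intro trap_sum_mono) auto
  then have "(f k)\<^sup>2 * L \<le> 2 * P + 2 * (L * D) * L"
    unfolding trap_sum_add trap_sum_cmult trap_sum_const[OF K] P_def L_def by simp
  then have "(f k)\<^sup>2 \<le> 2 / L * P + 2 * L * D"
    using L by (simp add: field_simps)
  also have "\<dots> \<le> (2 / L + 2 * L) * (P + D)"
    using mult_nonneg_nonneg[of "2 / L" D] mult_nonneg_nonneg[of "2 * L" P] L PD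
    unfolding distrib_left distrib_right by simp
  finally show ?thesis by (simp add: P_def D_def)
qed

section \<open>Energy estimate\<close>

text \<open>With \<open>a = V - u\<close> and \<open>b = u - w\<close>, the test function is
  \<open>V - w = a + b\<close> while \<open>V - 2 * u + w = a - b\<close>, so the time part becomes
  a difference of squares. The boundary conditions turn the boundary terms of summation by parts
  into those of \<open>norm_X\<close>.\<close>

lemma energy_estimate:
  fixes V u w g :: "int \<Rightarrow> real"
  assumes K: "K > 0" and dx: "dx > 0" and dt: "dt > 0" "dt \<le> 1 / 10"
    and eq: "\<And>k. k \<in> {0..int K} \<Longrightarrow>
      (V k - 2 * u k + w k) / dt\<^sup>2 = diff2_space dx (\<lambda>j. (V j + w j) / 2) k - g k"
    and bc0: "(V 0 - 2 * u 0 + w 0) / dt\<^sup>2 = diff_central dx (\<lambda>j. (V j + w j) / 2) 0"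
    and bcK: "(V (int K) - 2 * u (int K) + w (int K)) / dt\<^sup>2 =
      - diff_central dx (\<lambda>j. (V j + w j) / 2) (int K)"
    and g: "\<And>k. k \<in> {0..int K} \<Longrightarrow> \<bar>g k\<bar> \<le> G"
    and small: "4 * dt * G\<^sup>2 * (real K * dx) \<le> (norm_X K dx dt w (\<lambda>k. u k - w k))\<^sup>2"
  shows "(norm_X K dx dt V (\<lambda>k. V k - u k))\<^sup>2 \<le> 3 * (norm_X K dx dt w (\<lambda>k. u k - w k))\<^sup>2"
proof -
  define L where "L = real K * dx"
  define P where "P f = trap_sum K dx (\<lambda>k. (f k)\<^sup>2)" for f
  define X where "X f = (P f + (f 0)\<^sup>2 + (f (int K))\<^sup>2) / dt\<^sup>2" for f :: "int \<Rightarrow> real"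
  define D where "D f = grad_sq K dx f" for f
  define a where "a k = V k - u k" for k
  define b where "b k = u k - w k" for k
  define Z where "Z = (\<lambda>j. (V j + w j) / 2)"
  have P0: "P f \<ge> 0" for f using dx unfolding P_def by (auto intro!: trap_sum_nonneg)
  have D0: "D f \<ge> 0" for f using dx unfolding D_def by (auto intro!: grad_sq_nonneg)
  have PX: "P f \<le> dt\<^sup>2 * X f" for f using dt by (simp add: X_def)
  have X0: "X f \<ge> 0" for f using P0[of f] by (simp add: X_def)
  have prod: "(V k - 2 * u k + w k) / dt\<^sup>2 * (V k - w k) = ((a k)\<^sup>2 - (b k)\<^sup>2) / dt\<^sup>2" for k
    by (simp add: a_def b_def power2_eq_square algebra_simps)
  have "trap_sum K dx (\<lambda>k. diff2_space dx Z k * (V k - w k)) =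
      trap_sum K dx (\<lambda>k. 1 / dt\<^sup>2 * (a k)\<^sup>2 + ((- 1 / dt\<^sup>2) * (b k)\<^sup>2 + g k * (V k - w k)))"
  proof (rule trap_sum_cong)
    fix k assume "k \<in> {0..int K}"
    then have "diff2_space dx Z k = (V k - 2 * u k + w k) / dt\<^sup>2 + g k"
      using eq[of k] by (simp add: Z_def)
    then show "diff2_space dx Z k * (V k - w k) =
        1 / dt\<^sup>2 * (a k)\<^sup>2 + ((- 1 / dt\<^sup>2) * (b k)\<^sup>2 + g k * (V k - w k))"
      using prod[of k] by (simp add: ring_distribs diff_divide_distrib)
  qed
  also have "\<dots> = 1 / dt\<^sup>2 * P a + ((- 1 / dt\<^sup>2) * P b + trap_sum K dx (\<lambda>k. g k * (V k - w k)))"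
    unfolding trap_sum_add trap_sum_cmult P_def ..
  finally have 1: "trap_sum K dx (\<lambda>k. diff2_space dx Z k * (V k - w k)) =
      (P a - P b) / dt\<^sup>2 + trap_sum K dx (\<lambda>k. g k * (V k - w k))"
    by (simp add: diff_divide_distrib)
  have "diff_plus dx Z k * diff_plus dx (\<lambda>k. V k - w k) k * dx =
      (diff_plus dx V k)\<^sup>2 * dx / 2 - (diff_plus dx w k)\<^sup>2 * dx / 2" for k
    using dx by (simp add: diff_plus_def Z_def field_simps power2_eq_square)
  then have 2: "(\<Sum>k = 0..int K - 1. diff_plus dx Z k * diff_plus dx (\<lambda>k. V k - w k) k * dx) =
      (D V - D w) / 2"
    by (simp add: D_def sum_subtractf sum_divide_distrib diff_divide_distrib)
  have 3: "diff_central dx Z 0 * (V 0 - w 0) = ((a 0)\<^sup>2 - (b 0)\<^sup>2) / dt\<^sup>2"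
    "- diff_central dx Z (int K) * (V (int K) - w (int K)) = ((a (int K))\<^sup>2 - (b (int K))\<^sup>2) / dt\<^sup>2"
    using prod[of 0] prod[of "int K"] bc0 bcK unfolding Z_def by simp_all
  have energy: "X a - X b + (D V - D w) / 2 = - trap_sum K dx (\<lambda>k. g k * (V k - w k))"
    using summation_by_parts[OF K, of dx Z "\<lambda>k. V k - w k"] dx 1 2 3
    by (simp add: X_def add_divide_distrib diff_divide_distrib)
  have "- trap_sum K dx (\<lambda>k. g k * (V k - w k)) = trap_sum K dx (\<lambda>k. - 1 * (g k * (V k - w k)))"
    unfolding trap_sum_cmult by simp
  also have "\<dots> \<le> trap_sum K dx (\<lambda>k. dt * G\<^sup>2 + 1 / (2 * dt) * ((a k)\<^sup>2 + (b k)\<^sup>2))"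
  proof (rule trap_sum_mono)
    fix k assume k: "k \<in> {0..int K}"
    \<comment> \<open>The weight \<open>dt\<close> pays off below:
      \<open>P f \<le> dt\<^sup>2 * X f\<close> turns the factor \<open>1 / (2 * dt)\<close> into
      \<open>dt / 2\<close>, which is small enough to absorb.\<close>
    have young: "- (g k * c) \<le> dt * G\<^sup>2 / 2 + c\<^sup>2 / (2 * dt)" for c
    proof -
      have "(g k)\<^sup>2 \<le> G\<^sup>2" using g[OF k] by (metis abs_ge_zero power2_abs power_mono)
      then have "dt\<^sup>2 * (g k)\<^sup>2 \<le> dt\<^sup>2 * G\<^sup>2" by (intro mult_left_mono) auto
      moreover have "0 \<le> (dt * g k + c)\<^sup>2" by simp
      ultimately have "- (2 * dt * (g k * c)) \<le> dt\<^sup>2 * G\<^sup>2 + c\<^sup>2"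
        by (simp add: power2_eq_square algebra_simps)
      then show ?thesis using dt by (simp add: field_simps power2_eq_square)
    qed
    have "V k - w k = a k + b k" by (simp add: a_def b_def)
    then show "- 1 * (g k * (V k - w k)) \<le> dt * G\<^sup>2 + 1 / (2 * dt) * ((a k)\<^sup>2 + (b k)\<^sup>2)"
      using young[of "a k"] young[of "b k"] by (simp add: ring_distribs add_divide_distrib)
  qed (use dx in auto)
  also have "\<dots> = dt * G\<^sup>2 * L + 1 / (2 * dt) * (P a + P b)"
    unfolding trap_sum_add trap_sum_cmult trap_sum_const[OF K] L_def P_def by simp
  also have "\<dots> \<le> dt * G\<^sup>2 * L + 1 / (2 * dt) * (dt\<^sup>2 * X a + dt\<^sup>2 * X b)"
    using dt PX[of a] PX[of b] by (intro add_left_mono mult_left_mono) auto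
  also have "\<dots> = dt * G\<^sup>2 * L + dt * X a / 2 + dt * X b / 2"
    using dt by (simp add: field_simps power2_eq_square)
  finally have 4: "2 * X a + D V \<le> 2 * X b + D w + 2 * (dt * G\<^sup>2 * L) + dt * X a + dt * X b"
    using energy by (simp add: field_simps)
  \<comment> \<open>The energy identity does not control \<open>V\<close> itself, only its
    differences. The weighted square of \<open>V = w + (a + b)\<close> does, and again
    \<open>P f \<le> dt\<^sup>2 * X f\<close> compensates the factor \<open>1 / dt\<close>.\<close>
  have "P V \<le> trap_sum K dx (\<lambda>k. (1 + dt) * (w k)\<^sup>2 + (1 + 1 / dt) * (2 * ((a k)\<^sup>2 + (b k)\<^sup>2)))"
    unfolding P_def
  proof (rule trap_sum_mono)
    fix k
    have "0 \<le> (dt * w k - (a k + b k))\<^sup>2 / dt" using dt by simp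
    then have "2 * w k * (a k + b k) \<le> dt * (w k)\<^sup>2 + (a k + b k)\<^sup>2 / dt"
      using dt by (simp add: field_simps power2_eq_square)
    moreover have "V k = w k + (a k + b k)" by (simp add: a_def b_def)
    ultimately have "(V k)\<^sup>2 \<le> (1 + dt) * (w k)\<^sup>2 + (1 + 1 / dt) * (a k + b k)\<^sup>2"
      by (simp add: power2_sum ring_distribs add_divide_distrib)
    also have "\<dots> \<le> (1 + dt) * (w k)\<^sup>2 + (1 + 1 / dt) * (2 * ((a k)\<^sup>2 + (b k)\<^sup>2))"
      using dt zero_le_power2[of "a k - b k"]
      by (intro add_left_mono mult_left_mono) (auto simp: power2_eq_square algebra_simps)
    finally show "(V k)\<^sup>2 \<le> (1 + dt) * (w k)\<^sup>2 + (1 + 1 / dt) * (2 * ((a k)\<^sup>2 + (b k)\<^sup>2))" .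
  qed (use dx in auto)
  also have "\<dots> = (1 + dt) * P w + (1 + 1 / dt) * (2 * (P a + P b))"
    unfolding trap_sum_add trap_sum_cmult P_def ..
  also have "\<dots> \<le> (1 + dt) * P w + (1 + 1 / dt) * (2 * (dt\<^sup>2 * X a + dt\<^sup>2 * X b))"
    using dt PX[of a] PX[of b] by (intro add_left_mono mult_left_mono) auto
  also have "\<dots> = (1 + dt) * P w + (1 + dt) * (2 * dt * (X a + X b))"
    using dt by (simp add: field_simps power2_eq_square)
  also have "\<dots> \<le> (1 + dt) * P w + 2 * (2 * dt * (X a + X b))"
    using dt X0[of a] X0[of b] by (intro add_left_mono mult_right_mono) auto
  finally have 5: "P V \<le> P w + dt * P w + 4 * (dt * X a) + 4 * (dt * X b)"
    by (simp add: algebra_simps)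
  have 6: "dt * x \<le> 1 / 10 * x" if "x \<ge> 0" for x using mult_right_mono[OF dt(2) that] .
  have new: "(norm_X K dx dt V (\<lambda>k. V k - u k))\<^sup>2 = P V + D V + X a"
    and old: "(norm_X K dx dt w (\<lambda>k. u k - w k))\<^sup>2 = P w + D w + X b"
    using norm_X_sq[of dx K dt] dx unfolding P_def D_def X_def a_def b_def by auto
  \<comment> \<open>Adding \<open>4\<close> and \<open>5\<close> gives \<open>X b\<close> the
    coefficient \<open>2 + 5 * dt\<close>, at most \<open>5 / 2\<close>, and the forcing term adds
    \<open>1 / 2\<close>: this exhausts the factor 3. The remaining terms have slack.\<close>
  have "4 * (dt * G\<^sup>2 * L) \<le> P w + D w + X b"
    using small unfolding old L_def by (simp add: mult.assoc)
  then show ?thesis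
    unfolding new old using 4 5 6[OF X0[of a]] 6[OF X0[of b]] 6[OF P0[of w]] X0[of a] X0[of b] P0[of w] D0[of w]
    by argo
qed

section \<open>Bounds for the two-point difference quotient\<close>

lemma C2_has_derivs:
  assumes "C2 F"
  obtains F'' where "\<And>x. (F has_real_derivative deriv F x) (at x)"
    "\<And>x. (deriv F has_real_derivative F'' x) (at x)" "continuous_on UNIV F''"
proof -
  from assms obtain F' F'' where F': "\<And>x. (F has_real_derivative F' x) (at x)"
    and F'': "\<And>x. (deriv F has_real_derivative F'' x) (at x)" "continuous_on UNIV F''"
    unfolding C2_def C1_differentiable_on_def has_real_derivative_iff_has_vector_derivative by blast
  with that show ?thesis by (metis DERIV_imp_deriv)
qed

text \<open>Averaging the derivative over the segment from \<open>b\<close> to \<open>a\<close>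
  unifies both branches of \<open>diff_quot\<close>, so later bounds need no case distinction and do
  not degenerate as \<open>a\<close> approaches \<open>b\<close>.\<close>

lemma diff_quot_has_integral:
  assumes "\<And>x. (F has_real_derivative deriv F x) (at x)"
  shows "((\<lambda>t. deriv F (b + t * (a - b))) has_integral diff_quot F a b) {0..1}"
proof (cases "a = b")
  case True
  then show ?thesis using has_integral_const_real[of "deriv F a" 0 1] by (simp add: diff_quot_def)
next
  case False
  have "((\<lambda>t. F (b + t * (a - b)) / (a - b)) has_vector_derivative deriv F (b + t * (a - b)))
      (at t within {0..1})" for t
  proof -
    have "((\<lambda>t. F (b + t * (a - b))) has_real_derivative deriv F (b + t * (a - b)) * (a - b)) (at t)"
      by (rule DERIV_chain2[OF assms]) (auto intro!: derivative_eq_intros)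
    from has_field_derivative_at_within[OF DERIV_cdivide[OF this, of "a - b"], of "{0..1}"]
    show ?thesis
      using False by (simp add: has_real_derivative_iff_has_vector_derivative)
  qed
  from fundamental_theorem_of_calculus[OF _ this]
  show ?thesis using False by (simp add: diff_quot_def diff_divide_distrib)
qed

text \<open>In the mean value representation the segments stay in \<open>[-B, B]\<close>, where
  \<open>deriv F\<close> is bounded and, by the bound on the second derivative, Lipschitz; moving
  \<open>a\<close> moves the point of evaluation by at most as much.\<close>

lemma diff_quot_bounds:
  assumes "C2 F"
  obtains G Lp where "G \<ge> 0" "Lp \<ge> 0"
    "\<And>a b. \<lbrakk>\<bar>a\<bar> \<le> B; \<bar>b\<bar> \<le> B\<rbrakk> \<Longrightarrow> \<bar>diff_quot F a b\<bar> \<le> G"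
    "\<And>a a' b. \<lbrakk>\<bar>a\<bar> \<le> B; \<bar>a'\<bar> \<le> B; \<bar>b\<bar> \<le> B\<rbrakk> \<Longrightarrow>
      \<bar>diff_quot F a b - diff_quot F a' b\<bar> \<le> Lp * \<bar>a - a'\<bar>"
proof -
  obtain F'' where F': "\<And>x. (F has_real_derivative deriv F x) (at x)"
    and F'': "\<And>x. (deriv F has_real_derivative F'' x) (at x)" "continuous_on UNIV F''"
    using C2_has_derivs[OF assms] by blast
  have cont: "continuous_on UNIV (deriv F)"
    using F''(1) by (meson DERIV_continuous_on has_field_derivative_at_within)
  have bdd: "\<exists>M\<ge>0. \<forall>x\<in>{-B..B}. \<bar>f x\<bar> \<le> M" if "continuous_on UNIV f" for f :: "real \<Rightarrow> real"
  proof -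
    have "bounded (f ` {-B..B})"
      using that by (intro compact_imp_bounded compact_continuous_image)
        (auto intro: continuous_on_subset)
    then obtain M where "\<forall>x\<in>{-B..B}. \<bar>f x\<bar> \<le> M" by (auto simp: bounded_iff)
    \<comment> \<open>The absolute value secures nonnegativity even if \<open>B < 0\<close> and the
      interval is empty.\<close>
    then show ?thesis by (intro exI[of _ "\<bar>M\<bar>"]) fastforce
  qed
  obtain G where G: "G \<ge> 0" "\<forall>x\<in>{-B..B}. \<bar>deriv F x\<bar> \<le> G" using bdd[OF cont] by blast
  obtain Lp where Lp: "Lp \<ge> 0" "\<forall>x\<in>{-B..B}. \<bar>F'' x\<bar> \<le> Lp" using bdd[OF F''(2)] by blast
  have lip: "\<bar>deriv F x - deriv F y\<bar> \<le> Lp * \<bar>x - y\<bar>" if "x \<in> {-B..B}" "y \<in> {-B..B}" for x y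
    using field_differentiable_bound[of "{-B..B}" "deriv F" F'' Lp x y] F''(1) Lp that
    by (auto simp: has_field_derivative_at_within)
  have conv: "b + t * (a - b) \<in> {-B..B}" if "\<bar>a\<bar> \<le> B" "\<bar>b\<bar> \<le> B" "t \<in> {0..1}" for a b t
  proof -
    have "(1 - t) *\<^sub>R b + t *\<^sub>R a \<in> {-B..B}"
      using that convexD_alt[OF convex_real_interval(5), of b "-B" B a t] by (auto simp: abs_le_iff)
    then show ?thesis by (simp add: algebra_simps)
  qed
  note int = diff_quot_has_integral[OF F']
  show ?thesis
  proof (rule that[OF G(1) Lp(1)])
    fix a b assume "\<bar>a\<bar> \<le> B" "\<bar>b\<bar> \<le> B"
    then show "\<bar>diff_quot F a b\<bar> \<le> G"
      using has_integral_bound_real[OF G(1) finite.emptyI int[where a = a and b = b]] G(2) conv by simp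
  next
    fix a a' b assume ab: "\<bar>a\<bar> \<le> B" "\<bar>a'\<bar> \<le> B" "\<bar>b\<bar> \<le> B"
    have "\<bar>deriv F (b + t * (a - b)) - deriv F (b + t * (a' - b))\<bar> \<le> Lp * \<bar>a - a'\<bar>"
      if t: "t \<in> {0..1}" for t
    proof -
      have "\<bar>deriv F (b + t * (a - b)) - deriv F (b + t * (a' - b))\<bar>
          \<le> Lp * \<bar>(b + t * (a - b)) - (b + t * (a' - b))\<bar>"
        using ab t by (intro lip conv) auto
      also have "(b + t * (a - b)) - (b + t * (a' - b)) = t * (a - a')" by (simp add: algebra_simps)
      also have "Lp * \<bar>t * (a - a')\<bar> \<le> Lp * \<bar>a - a'\<bar>"
        using t Lp(1) by (intro mult_left_mono) (auto simp: abs_mult mult_left_le_one_le)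
      finally show ?thesis .
    qed
    then show "\<bar>diff_quot F a b - diff_quot F a' b\<bar> \<le> Lp * \<bar>a - a'\<bar>"
      using has_integral_bound_real[OF _ finite.emptyI has_integral_diff[OF int[where a = a and b = b] int[where a = a' and b = b]], where B = "Lp * \<bar>a - a'\<bar>"] Lp(1)
      by simp
  qed
qed

section \<open>Solvability for small time steps\<close>

text \<open>The restrictions on \<open>dt\<close> serve separate ends: \<open>dtL\<close> makes the
  recursion monotone, while \<open>dtG\<close> and \<open>dt \<le> 1 / 10\<close> are what
  \<open>energy_estimate\<close> needs. The value of \<open>B\<close> is the Sobolev bound on
  functions whose squared norm is at most \<open>3 * M\<^sup>2\<close>.\<close>

lemma solvability_in_ball:
  fixes U :: "nat \<Rightarrow> int \<Rightarrow> real"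
  assumes K: "K > 0" and n: "n \<ge> 1" and dt: "dt > 0" "dt \<le> 1 / 10"
    and dx: "dx > 0" and L: "real K * dx = L"
    and G: "\<And>a b. \<lbrakk>\<bar>a\<bar> \<le> B; \<bar>b\<bar> \<le> B\<rbrakk> \<Longrightarrow> \<bar>diff_quot F a b\<bar> \<le> G"
    and Lp: "Lp \<ge> 0" and lip: "\<And>a a' b. \<lbrakk>\<bar>a\<bar> \<le> B; \<bar>a'\<bar> \<le> B; \<bar>b\<bar> \<le> B\<rbrakk> \<Longrightarrow>
      \<bar>diff_quot F a b - diff_quot F a' b\<bar> \<le> Lp * \<bar>a - a'\<bar>"
    and B: "B = sqrt (3 * (2 / L + 2 * L)) * M" and M: "M = M_data K dx dt U n"
    and dtL: "dt\<^sup>2 * Lp \<le> 1" and dtG: "4 * dt * G\<^sup>2 * L \<le> M\<^sup>2"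
  shows "\<exists>!V. V \<in> {-1..int K + 1} \<rightarrow>\<^sub>E UNIV \<and> scheme F K dx dt (U(n + 1 := V)) n \<and>
             restrict V {0..int K} \<in> X_M K dx dt U n"
proof -
  define u where "u = U n"
  define w where "w = U (n - 1)"
  have L0: "L > 0" using L K dx by auto
  have Meq: "M = norm_X K dx dt w (\<lambda>k. u k - w k)" by (simp add: M M_data_def u_def w_def)
  have M0: "M \<ge> 0" unfolding Meq norm_X_def norm_H1_def norm_L2_def
    using dx by (auto intro!: add_nonneg_nonneg trap_sum_nonneg sum_nonneg)
  have B0: "B \<ge> 0" using B M0 L0 by simp
  have sup: "\<bar>f k\<bar> \<le> B" if "(norm_X K dx dt f h)\<^sup>2 \<le> 3 * M\<^sup>2" "k \<in> {0..int K}" for f h k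
  proof -
    have "trap_sum K dx (\<lambda>k. (f k)\<^sup>2) + grad_sq K dx f \<le> (norm_X K dx dt f h)\<^sup>2"
      using norm_X_sq[of dx K dt f h] trap_sum_nonneg[of dx "\<lambda>k. (h k)\<^sup>2" K] dx by simp
    then have "(2 / L + 2 * L) * (trap_sum K dx (\<lambda>k. (f k)\<^sup>2) + grad_sq K dx f) \<le>
        (2 / L + 2 * L) * (3 * M\<^sup>2)"
      using that(1) L0 by (intro mult_left_mono) auto
    also have "\<dots> = B\<^sup>2" using L0 by (simp add: B power_mult_distrib)
    finally have "(f k)\<^sup>2 \<le> B\<^sup>2"
      using discrete_sobolev[OF K dx that(2), of f, unfolded L] by (rule order_trans[rotated])
    then show ?thesis using B0 abs_le_square_iff[of "f k" B] by simp
  qed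
  \<comment> \<open>The old data lie in the same ball, as their squared norm is
    \<open>M\<^sup>2\<close>.\<close>
  have wB: "\<bar>w k\<bar> \<le> B" if "k \<in> {0..int K}" for k
    using sup[of w "\<lambda>k. u k - w k" k] that by (simp add: Meq)
  \<comment> \<open>Clipping is 1-Lipschitz, so \<open>g k\<close> inherits the local constant
    \<open>Lp\<close> on the whole line.\<close>
  define clip where "clip v = max (- B) (min B v)" for v
  define g where "g k v = diff_quot F (clip v) (w k)" for k v
  have clipB: "\<bar>clip v\<bar> \<le> B" for v using B0 by (auto simp: clip_def)
  have clip_id: "clip v = v" if "\<bar>v\<bar> \<le> B" for v using that by (auto simp: clip_def)
  have g_lip: "\<bar>g k s - g k t\<bar> \<le> Lp * \<bar>s - t\<bar>" if k: "k \<in> {0..int K}" for k s t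
  proof -
    have "\<bar>g k s - g k t\<bar> \<le> Lp * \<bar>clip s - clip t\<bar>"
      unfolding g_def by (intro lip clipB wB k)
    also have "\<dots> \<le> Lp * \<bar>s - t\<bar>"
      using Lp by (intro mult_left_mono) (auto simp: clip_def)
    finally show ?thesis .
  qed
  define acc where "acc v k = (v - 2 * u k + w k) / dt\<^sup>2" for v k
  \<comment> \<open>Multiplying the equations by \<open>2 * dx\<^sup>2\<close> and
    \<open>4 * dx\<close> clears the spatial denominators, including the 2 from averaging
    \<open>V\<close> and \<open>w\<close>; the known values of \<open>w\<close> move to the other
    side.\<close>
  define p where "p k v = 2 * dx\<^sup>2 * (acc v k + g k v) - (w (k + 1) - 2 * w k + w (k - 1))" for k v
  define q where "q v = 4 * dx * acc v 0 - (w 1 - w (-1))" for v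
  define r where "r v = 4 * dx * acc v (int K) + (w (int K + 1) - w (int K - 1))" for v
  define truncated where "truncated V \<longleftrightarrow>
    (\<forall>k\<in>{0..int K}. acc (V k) k = diff2_space dx (\<lambda>j. (V j + w j) / 2) k - g k (V k)) \<and>
    acc (V 0) 0 = diff_central dx (\<lambda>j. (V j + w j) / 2) 0 \<and>
    acc (V (int K)) (int K) = - diff_central dx (\<lambda>j. (V j + w j) / 2) (int K)" for V
  have truncated_iff: "truncated V \<longleftrightarrow>
      (\<forall>k\<in>{0..int K}. V (k + 1) - 2 * V k + V (k - 1) = p k (V k)) \<and>
      V 1 - V (-1) = q (V 0) \<and> r (V (int K)) + V (int K + 1) - V (int K - 1) = 0" for V
  proof -
    have "x = diff2_space dx (\<lambda>j. (V j + w j) / 2) k - y \<longleftrightarrow>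
        V (k + 1) - 2 * V k + V (k - 1) = 2 * dx\<^sup>2 * (x + y) - (w (k + 1) - 2 * w k + w (k - 1))"
      for x y k using dx by (auto simp: diff2_space_def field_simps)
    moreover have "x = diff_central dx (\<lambda>j. (V j + w j) / 2) 0 \<longleftrightarrow>
        V 1 - V (-1) = 4 * dx * x - (w 1 - w (-1))" for x
      using dx by (auto simp: diff_central_def field_simps)
    moreover have "x = - diff_central dx (\<lambda>j. (V j + w j) / 2) (int K) \<longleftrightarrow>
        4 * dx * x + (w (int K + 1) - w (int K - 1)) + V (int K + 1) - V (int K - 1) = 0" for x
      using dx by (auto simp: diff_central_def field_simps)
    ultimately show ?thesis unfolding truncated_def p_def q_def r_def by simp
  qed
  have scheme_iff: "scheme F K dx dt (U(n + 1 := V)) n \<longleftrightarrow> truncated V"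
    if "\<And>k. k \<in> {0..int K} \<Longrightarrow> \<bar>V k\<bar> \<le> B" for V
    using that n unfolding scheme_def truncated_def
    by (simp add: diff2_time_def acc_def g_def clip_id u_def w_def eq_neg_iff_add_eq_0)
  have X_M_iff: "restrict V {0..int K} \<in> X_M K dx dt U n \<longleftrightarrow>
      (norm_X K dx dt V (\<lambda>k. V k - u k))\<^sup>2 \<le> 3 * M\<^sup>2" for V
  proof -
    have "norm_X K dx dt (restrict V {0..int K}) (\<lambda>k. restrict V {0..int K} k - U n k) =
        norm_X K dx dt V (\<lambda>k. V k - u k)"
      by (rule norm_X_cong) (auto simp: u_def)
    then show ?thesis by (simp add: X_M_def M)
  qed
  have energy: "(norm_X K dx dt V (\<lambda>k. V k - u k))\<^sup>2 \<le> 3 * M\<^sup>2" if "truncated V" for V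
    unfolding Meq
    by (rule energy_estimate[where g = "\<lambda>k. g k (V k)" and G = G])
      (use that K dx dt dtG G[OF clipB wB] in \<open>auto simp: truncated_def acc_def g_def L Meq\<close>)
  have iff: "scheme F K dx dt (U(n + 1 := V)) n \<and> restrict V {0..int K} \<in> X_M K dx dt U n \<longleftrightarrow>
      truncated V" for V
    using scheme_iff[of V] sup[of V "\<lambda>k. V k - u k"] energy[of V] X_M_iff[of V] by blast
  have acc_diff: "acc t k - acc s k = (t - s) / dt\<^sup>2" for s t k
    by (simp add: acc_def diff_divide_distrib[symmetric])
  have acc_cont: "continuous_on UNIV (\<lambda>v. acc v k)" for k
    unfolding acc_def by (intro continuous_intros) (use dt in auto)
  have "\<exists>!V. V \<in> {-1..int K + 1} \<rightarrow>\<^sub>E UNIV \<and> truncated V"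
    unfolding truncated_iff
  \<comment> \<open>The rate \<open>c\<close> is the slope of the affine function
    \<open>r\<close>.\<close>
  proof (rule three_term_bvp_ex1[OF K, where c = "4 * dx / dt\<^sup>2"])
    fix k assume k: "k \<in> {0..int K}"
    have "Lp-lipschitz_on UNIV (g k)"
      using g_lip[OF k] by (intro lipschitz_onI) (auto simp: dist_real_def Lp)
    then have "continuous_on UNIV (g k)" by (rule lipschitz_on_continuous_on)
    then show "continuous_on UNIV (p k)"
      unfolding p_def by (intro continuous_intros acc_cont)
    show "mono (p k)"
    proof (rule monoI)
      fix s t :: real assume st: "s \<le> t"
      \<comment> \<open>The slope \<open>1 / dt\<^sup>2\<close> of \<open>acc\<close> dominates any
        decrease of \<open>g k\<close>.\<close>
      have "Lp * (t - s) \<le> 1 / dt\<^sup>2 * (t - s)"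
        using st dtL dt by (intro mult_right_mono) (auto simp: field_simps)
      then have "acc s k + g k s \<le> acc t k + g k t"
        using g_lip[OF k, of s t] acc_diff[of t k s] st by (simp add: abs_le_iff)
      then have "2 * dx\<^sup>2 * (acc s k + g k s) \<le> 2 * dx\<^sup>2 * (acc t k + g k t)"
        by (intro mult_left_mono) auto
      then show "p k s \<le> p k t" by (simp add: p_def)
    qed
  next
    show "continuous_on UNIV q" "continuous_on UNIV r"
      unfolding q_def r_def by (intro continuous_intros acc_cont)+
    show "mono q"
    proof (rule monoI)
      fix s t :: real assume "s \<le> t"
      then have "acc s 0 \<le> acc t 0" using acc_diff[of t 0 s] by (smt (verit) divide_nonneg_nonneg zero_le_power2)
      then show "q s \<le> q t" using dx by (simp add: q_def)
    qed
    show "4 * dx / dt\<^sup>2 > 0" using dx dt by simp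
    show "4 * dx / dt\<^sup>2 * (t - s) \<le> r t - r s" for s t
      using acc_diff[of t "int K" s] by (simp add: r_def right_diff_distrib[symmetric])
  qed
  then show ?thesis using iff by simp
qed

text \<open>\<open>R\<close> can precede the quantifiers over grid, data and time step, because
  \<open>B\<close>, and with it \<open>G\<close> and \<open>Lp\<close>, is built from
  \<open>F\<close>, \<open>L\<close> and \<open>M\<close> alone.\<close>

lemma timestep_bound:
  fixes F :: "real \<Rightarrow> real" and L M :: real
  assumes L: "L > 0" and F: "C2 F"
  shows "\<exists>R>0. \<forall>(K :: nat) (n :: nat) (U :: nat \<Rightarrow> int \<Rightarrow> real) (dt :: real) (dx :: real).
       K > 0 \<longrightarrow> n \<ge> 1 \<longrightarrow> dt > 0 \<longrightarrow> dx = L / real K \<longrightarrow> M_data K dx dt U n = M \<longrightarrow>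
       (M = 0 \<longrightarrow> deriv F 0 = 0) \<longrightarrow> dt < R \<longrightarrow>
       (\<exists>!V. V \<in> {-1..int K + 1} \<rightarrow>\<^sub>E UNIV \<and>
             scheme F K dx dt (U(n + 1 := V)) n \<and>
             restrict V {0..int K} \<in> X_M K dx dt U n)"
proof -
  define B where "B = sqrt (3 * (2 / L + 2 * L)) * M"
  obtain G Lp where G0: "G \<ge> 0" and Lp0: "Lp \<ge> 0"
    and G: "\<And>a b. \<lbrakk>\<bar>a\<bar> \<le> B; \<bar>b\<bar> \<le> B\<rbrakk> \<Longrightarrow> \<bar>diff_quot F a b\<bar> \<le> G"
    and lip: "\<And>a a' b. \<lbrakk>\<bar>a\<bar> \<le> B; \<bar>a'\<bar> \<le> B; \<bar>b\<bar> \<le> B\<rbrakk> \<Longrightarrow>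
      \<bar>diff_quot F a b - diff_quot F a' b\<bar> \<le> Lp * \<bar>a - a'\<bar>"
    using diff_quot_bounds[OF F] by blast
  \<comment> \<open>For \<open>M = 0\<close> no positive bound on the difference quotient would do, but then \<open>B = 0\<close> and only
    \<open>diff_quot F 0 0 = deriv F 0 = 0\<close> matters.\<close>
  define G' where "G' = (if M = 0 then 0 else G)"
  have G': "\<bar>diff_quot F a b\<bar> \<le> G'" if "\<bar>a\<bar> \<le> B" "\<bar>b\<bar> \<le> B" "M = 0 \<longrightarrow> deriv F 0 = 0" for a b
    using that G by (cases "M = 0") (auto simp: G'_def B_def diff_quot_def)
  \<comment> \<open>The three bounds yield in turn the energy estimate,
    \<open>dt\<^sup>2 * Lp \<le> 1\<close> and \<open>dtG\<close>; each added 1 keeps a denominator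
    positive. For \<open>M = 0\<close> the last bound would be zero.\<close>
  define R where "R = (if M = 0 then min (1 / 10) (1 / (Lp + 1))
    else min (min (1 / 10) (1 / (Lp + 1))) (M\<^sup>2 / (4 * G\<^sup>2 * L + 1)))"
  have den: "4 * G\<^sup>2 * L + 1 > 0" using L by (intro add_nonneg_pos) auto
  have "R > 0" using Lp0 den by (auto simp: R_def)
  moreover have "\<exists>!V. V \<in> {-1..int K + 1} \<rightarrow>\<^sub>E UNIV \<and> scheme F K dx dt (U(n + 1 := V)) n \<and>
      restrict V {0..int K} \<in> X_M K dx dt U n"
    if K: "K > 0" and n: "n \<ge> 1" and dt: "dt > 0" and dx: "dx = L / real K"
      and M: "M_data K dx dt U n = M" and M0: "M = 0 \<longrightarrow> deriv F 0 = 0" and R: "dt < R"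
    for K n U dt dx
  proof -
    have dt': "dt \<le> 1 / 10" "dt \<le> 1 / (Lp + 1)" using R by (auto simp: R_def split: if_splits)
    have "dt * (dt * Lp) \<le> 1 * 1"
      using dt dt' Lp0 by (intro mult_mono) (auto simp: field_simps)
    then have dtL: "dt\<^sup>2 * Lp \<le> 1" by (simp add: power2_eq_square mult.assoc)
    have dtG: "4 * dt * G'\<^sup>2 * L \<le> M\<^sup>2"
    proof (cases "M = 0")
      case False
      then have "dt * (4 * G\<^sup>2 * L + 1) \<le> M\<^sup>2"
        using R den by (simp add: R_def less_divide_eq)
      then show ?thesis using False dt by (simp add: G'_def algebra_simps)
    qed (simp add: G'_def)
    show ?thesis
      by (rule solvability_in_ball[OF K n dt dt'(1) _ _ G' Lp0 lip B_def M[symmetric] dtL dtG])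
        (use K L dx M0 in auto)
  qed
  ultimately show ?thesis by (intro exI[of _ R] conjI allI impI)
qed

theorem theorem4p1:
  fixes F :: "real \<Rightarrow> real" and L :: real
  assumes L: "L > 0" and F: "C2 F"
  shows "\<exists>R\<^sub>1 :: real \<Rightarrow> real. (\<forall>M. R\<^sub>1 M > 0) \<and>
    (\<forall>(T :: real) (N :: nat) (K :: nat) (n :: nat) (U :: nat \<Rightarrow> int \<Rightarrow> real) (dt :: real) (dx :: real).
       T > 0 \<longrightarrow> N > 0 \<longrightarrow> K > 0 \<longrightarrow> n \<ge> 1 \<longrightarrow>
       dt = T / real N \<longrightarrow> dx = L / real K \<longrightarrow>
       (M_data K dx dt U n = 0 \<longrightarrow> deriv F 0 = 0) \<longrightarrow>
       dt < R\<^sub>1 (M_data K dx dt U n) \<longrightarrow>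
       (\<exists>!V. V \<in> {-1..int K + 1} \<rightarrow>\<^sub>E UNIV \<and>
             scheme F K dx dt (U(n + 1 := V)) n \<and>
             restrict V {0..int K} \<in> X_M K dx dt U n))"
proof -
  \<comment> \<open>Choice over \<open>M\<close> turns the bounds into a function; \<open>T\<close>
    and \<open>N\<close> enter only through \<open>dt > 0\<close>.\<close>
  have "\<exists>R\<^sub>1 :: real \<Rightarrow> real. \<forall>M. R\<^sub>1 M > 0 \<and> (\<forall>K n U dt dx.
       K > 0 \<longrightarrow> n \<ge> 1 \<longrightarrow> dt > 0 \<longrightarrow> dx = L / real K \<longrightarrow> M_data K dx dt U n = M \<longrightarrow>
       (M = 0 \<longrightarrow> deriv F 0 = 0) \<longrightarrow> dt < R\<^sub>1 M \<longrightarrow>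
       (\<exists>!V. V \<in> {-1..int K + 1} \<rightarrow>\<^sub>E UNIV \<and>
             scheme F K dx dt (U(n + 1 := V)) n \<and>
             restrict V {0..int K} \<in> X_M K dx dt U n))"
    (is "\<exists>R. ?P R")
    by (intro choice allI timestep_bound L F)
  then obtain R\<^sub>1 where R: "?P R\<^sub>1" ..
  show ?thesis
  proof (intro exI[of _ R\<^sub>1] conjI allI impI)
    show "R\<^sub>1 M > 0" for M using R by blast
  next
    fix T dt dx :: real and N K n :: nat and U :: "nat \<Rightarrow> int \<Rightarrow> real"
    assume "T > 0" "N > 0" "K > 0" "n \<ge> 1" "dt = T / real N" "dx = L / real K"
      "M_data K dx dt U n = 0 \<longrightarrow> deriv F 0 = 0" "dt < R\<^sub>1 (M_data K dx dt U n)"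
    moreover from this have "dt > 0" by simp
    ultimately show "\<exists>!V. V \<in> {-1..int K + 1} \<rightarrow>\<^sub>E UNIV \<and>
             scheme F K dx dt (U(n + 1 := V)) n \<and>
             restrict V {0..int K} \<in> X_M K dx dt U n"
      using R[THEN spec, of "M_data K dx dt U n"] by simp
  qed
qed

end
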